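(* Let $0\le m\le n$ and let $M=U^m_n$ be the uniform matroid with ground set $E$. Let $\pi=(B_1,\dots,B_j)$ be an ordered set partition of $E$ with $k_i=|B_i|$, let $\ell$ be the least integer such that $k_1+\cdots+k_\ell\ge m$, and let $T(\pi)$ be the term associated to $\pi$. Then: (1) If $k_1+\cdots+k_\ell=m$, then $T(\pi)$ is $U^m_m$ with ground set $B_1\cup\cdots\cup B_\ell$. (2) If $k_1+\cdots+k_\ell>m$, then \[ T(\pi)=U^{k_1+\cdots+k_{\ell-1}}_{k_1+\cdots+k_{\ell-1}}\oplus U^{m-k_1-\cdots-k_{\ell-1}}_{k_\ell}, \] where the first summand has ground set $B_1\cup\cdots\cup B_{\ell-1}$ and the second summand has ground set $B_\ell$.
   Context: Matroid notions: for a matroid $M=(E,\mathcal{I})$, the restriction $M|_A$ is the matroid on $A$ whose independent sets are the independent sets of $M$ contained in $A$; the contraction $M/e$ of a non-loop $e$ is the matroid on $E-\{e\}$ with independent sets $\{I\subseteq E-\{e\}: I\cup\{e\}\in\mathcal{I}\}$ (for a loop it is deletion), and $M/A$ contracts the elements of $A$ one at a time; $\oplus$ is direct sum of matroids on disjoint ground sets. The uniform matroid $U^m_n$ ($0\le m\le n$) is the matroid on an $n$-element set whose independent sets are all subsets of size at most $m$; $U^t_k$ with a specified ground set of size $k$ means the uniform matroid of rank $t$ on that set. For an ordered set partition $\pi=(B_1,\dots,B_k)$ of $E$ (nonempty pairwise disjoint parts with union $E$), the term associated to $\pi$ is \[T(\pi)=M|_{B_1}\oplus (M/B_1)|_{B_2}\oplus\cdots\oplus\Big(M/\bigcup_{i=1}^{k-2}B_i\Big)\Big|_{B_{k-1}}\oplus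 M/\bigcup_{i=1}^{k-1}B_i.\]
   Formalization: T(π) has ground set E, so the stated equalities fail when ℓ<j; they are proved with an added rank-0 uniform summand (loops) on E−(B_1∪⋯∪B_ℓ), and also as stated after deleting the loops of T(π). *)

theory Defs
  imports Main "HOL-Library.Disjoint_Sets"
begin

definition is_matroid :: "'a set \<Rightarrow> 'a set set \<Rightarrow> bool" where
  "is_matroid E \<I> \<longleftrightarrow>
     finite E \<and> (\<forall>I\<in>\<I>. I \<subseteq> E) \<and> {} \<in> \<I> \<and>
     (\<forall>I\<in>\<I>. \<forall>J. J \<subseteq> I \<longrightarrow> J \<in> \<I>) \<and>
     (\<forall>I\<in>\<I>. \<forall>J\<in>\<I>. card I < card J \<longrightarrow> (\<exists>x\<in>J - I. insert x I \<in> \<I>))"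

lemma is_matroidI:
  assumes "finite E" "\<And>I. I \<in> \<I> \<Longrightarrow> I \<subseteq> E" "{} \<in> \<I>"
    and "\<And>I J. I \<in> \<I> \<Longrightarrow> J \<subseteq> I \<Longrightarrow> J \<in> \<I>"
    and "\<And>I J. I \<in> \<I> \<Longrightarrow> J \<in> \<I> \<Longrightarrow> card I < card J \<Longrightarrow> \<exists>x\<in>J - I. insert x I \<in> \<I>"
  shows "is_matroid E \<I>"
  using assms unfolding is_matroid_def by blast

lemma is_matroid_empty: "is_matroid {} {{}}"
  by (rule is_matroidI) auto

typedef 'a matroid = "{(E :: 'a set, \<I>). is_matroid E \<I>}"
  using is_matroid_empty by blast

setup_lifting type_definition_matroid

lift_definition ground :: "'a matroid \<Rightarrow> 'a set" is fst .

lift_definition indep :: "'a matroid \<Rightarrow> 'a set set" is snd .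

lemma matroid_axioms: "is_matroid (ground M) (indep M)"
  by transfer auto

lemma matroid_eqI: "ground M = ground N \<Longrightarrow> indep M = indep N \<Longrightarrow> M = N"
  by transfer (auto simp: prod_eq_iff)

text \<open>The uniform matroid of rank \<open>m\<close> on the ground set \<open>E\<close>. It is meant for finite \<open>E\<close>
  with \<open>m \<le> card E\<close>; for infinite \<open>E\<close> it is the empty matroid.\<close>

lift_definition uniform :: "nat \<Rightarrow> 'a set \<Rightarrow> 'a matroid"
  is "\<lambda>m E. if finite E then (E, {I. I \<subseteq> E \<and> card I \<le> m}) else ({}, {{}})"
proof -
  fix m and E :: "'a set"
  have "is_matroid E {I. I \<subseteq> E \<and> card I \<le> m}" if fin: "finite E"
  proof -
    show ?thesis
    proof (rule is_matroidI)
      fix I J assume I: "I \<in> {I. I \<subseteq> E \<and> card I \<le> m}" and JI: "J \<subseteq> I"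
      have "finite I" using I fin finite_subset by blast
      then have "card J \<le> card I" using JI by (rule card_mono)
      then show "J \<in> {I. I \<subseteq> E \<and> card I \<le> m}" using I JI by auto
    next
      fix I J
      assume I: "I \<in> {I. I \<subseteq> E \<and> card I \<le> m}" and J: "J \<in> {I. I \<subseteq> E \<and> card I \<le> m}"
        and c: "card I < card J"
      have "finite I" using I fin finite_subset by blast
      then have "\<not> J \<subseteq> I" using c card_mono leD by blast
      then obtain x where "x \<in> J" "x \<notin> I" by blast
      moreover have "card (insert x I) \<le> m" using \<open>x \<notin> I\<close> \<open>finite I\<close> J c by simp
      ultimately show "\<exists>x\<in>J - I. insert x I \<in> {I. I \<subseteq> E \<and> card I \<le> m}"
        using I J by (intro bexI[of _ x]) auto
    qed (use fin in auto)
  qed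
  then show "(if finite E then (E, {I. I \<subseteq> E \<and> card I \<le> m}) else ({}, {{}}))
               \<in> {(E, \<I>). is_matroid E \<I>}"
    by (simp add: is_matroid_empty)
qed

lemma ground_uniform: "finite E \<Longrightarrow> ground (uniform m E) = E"
  and indep_uniform: "finite E \<Longrightarrow> indep (uniform m E) = {I. I \<subseteq> E \<and> card I \<le> m}"
  by (transfer; simp)+

lift_definition restriction :: "'a matroid \<Rightarrow> 'a set \<Rightarrow> 'a matroid"
  is "\<lambda>(E, \<I>) A. (E \<inter> A, {I \<in> \<I>. I \<subseteq> A})"
proof -
  fix M :: "'a set \<times> 'a set set" and A :: "'a set"
  obtain E \<I> where M: "M = (E, \<I>)" by force
  assume "M \<in> {(E, \<I>). is_matroid E \<I>}"
  then have E: "is_matroid E \<I>" using M by simp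
  then have fin: "finite E" and sub: "\<And>I. I \<in> \<I> \<Longrightarrow> I \<subseteq> E" and emp: "{} \<in> \<I>"
    and down: "\<And>I J. I \<in> \<I> \<Longrightarrow> J \<subseteq> I \<Longrightarrow> J \<in> \<I>"
    and aug: "\<And>I J. I \<in> \<I> \<Longrightarrow> J \<in> \<I> \<Longrightarrow> card I < card J \<Longrightarrow> \<exists>x\<in>J - I. insert x I \<in> \<I>"
    unfolding is_matroid_def by blast+
  have "is_matroid (E \<inter> A) {I \<in> \<I>. I \<subseteq> A}"
  proof (rule is_matroidI)
    show "finite (E \<inter> A)" "{} \<in> {I \<in> \<I>. I \<subseteq> A}" using fin emp by simp_all
  next
    fix I assume "I \<in> {I \<in> \<I>. I \<subseteq> A}"
    then show "I \<subseteq> E \<inter> A" using sub by simp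
  next
    fix I J assume "I \<in> {I \<in> \<I>. I \<subseteq> A}" "J \<subseteq> I"
    then show "J \<in> {I \<in> \<I>. I \<subseteq> A}" using down[of I J] by blast
  next
    fix I J
    assume I: "I \<in> {I \<in> \<I>. I \<subseteq> A}" and J: "J \<in> {I \<in> \<I>. I \<subseteq> A}" and c: "card I < card J"
    then obtain x where "x \<in> J - I" "insert x I \<in> \<I>"
      using aug[of I J] by blast
    then show "\<exists>x\<in>J - I. insert x I \<in> {I \<in> \<I>. I \<subseteq> A}"
      using I J by (intro bexI[of _ x]) auto
  qed
  then show "(case M of (E, \<I>) \<Rightarrow> \<lambda>A. (E \<inter> A, {I \<in> \<I>. I \<subseteq> A})) A \<in> {(E, \<I>). is_matroid E \<I>}"
    by (simp add: M)
qed

lemma ground_restriction: "ground (restriction M A) = ground M \<inter> A"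
  and indep_restriction: "indep (restriction M A) = {I \<in> indep M. I \<subseteq> A}"
  by (transfer; auto)+

text \<open>Contraction of a single element. If \<open>{e}\<close> is dependent then \<open>e\<close> is a loop and is deleted
  (or \<open>e\<close> is not in the ground set at all and nothing happens).\<close>

lift_definition contract_elem :: "'a \<Rightarrow> 'a matroid \<Rightarrow> 'a matroid"
  is "\<lambda>e (E, \<I>). (E - {e},
        if {e} \<in> \<I> then {I. I \<subseteq> E - {e} \<and> I \<union> {e} \<in> \<I>} else {I \<in> \<I>. I \<subseteq> E - {e}})"
proof -
  fix M :: "'a set \<times> 'a set set" and e :: 'a
  obtain E \<I> where M: "M = (E, \<I>)" by force
  assume "M \<in> {(E, \<I>). is_matroid E \<I>}"
  then have E: "is_matroid E \<I>" using M by simp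
  then have fin: "finite E" and sub: "\<And>I. I \<in> \<I> \<Longrightarrow> I \<subseteq> E" and emp: "{} \<in> \<I>"
    and down: "\<And>I J. I \<in> \<I> \<Longrightarrow> J \<subseteq> I \<Longrightarrow> J \<in> \<I>"
    and aug: "\<And>I J. I \<in> \<I> \<Longrightarrow> J \<in> \<I> \<Longrightarrow> card I < card J \<Longrightarrow> \<exists>x\<in>J - I. insert x I \<in> \<I>"
    unfolding is_matroid_def by blast+
  let ?E = "E - {e}"
  let ?\<I> = "if {e} \<in> \<I> then {I. I \<subseteq> ?E \<and> I \<union> {e} \<in> \<I>} else {I \<in> \<I>. I \<subseteq> ?E}"
  have "is_matroid ?E ?\<I>"
  proof (cases "{e} \<in> \<I>")
    case True
    have "J \<union> {e} \<in> \<I>" if "I \<union> {e} \<in> \<I>" "J \<subseteq> I" for I J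
      using down[OF that(1), of "J \<union> {e}"] that(2) by blast
    moreover have "\<exists>x\<in>J - I. insert x I \<subseteq> ?E \<and> insert x I \<union> {e} \<in> \<I>"
      if I: "I \<subseteq> ?E" "I \<union> {e} \<in> \<I>" and J: "J \<subseteq> ?E" "J \<union> {e} \<in> \<I>" and c: "card I < card J" for I J
    proof -
      have "finite I" "finite J" "e \<notin> I" "e \<notin> J"
        using I J fin finite_subset by blast+
      then have "card (I \<union> {e}) < card (J \<union> {e})" using c by simp
      from aug[OF I(2) J(2) this] obtain x
        where "x \<in> (J \<union> {e}) - (I \<union> {e})" "insert x (I \<union> {e}) \<in> \<I>" by blast
      then show ?thesis using I J by (intro bexI[of _ x]) (auto simp: insert_commute)
    qed
    ultimately show ?thesis
      using True fin unfolding is_matroid_def by auto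
  next
    case False
    have "is_matroid ?E {I \<in> \<I>. I \<subseteq> ?E}"
    proof (rule is_matroidI)
      fix I J
      assume "I \<in> {I \<in> \<I>. I \<subseteq> ?E}" "J \<in> {I \<in> \<I>. I \<subseteq> ?E}" "card I < card J"
      then show "\<exists>x\<in>J - I. insert x I \<in> {I \<in> \<I>. I \<subseteq> ?E}"
        using aug[of I J] by blast
    next
      fix I J
      assume "I \<in> {I \<in> \<I>. I \<subseteq> ?E}" "J \<subseteq> I"
      then show "J \<in> {I \<in> \<I>. I \<subseteq> ?E}" using down[of I J] by blast
    qed (use fin emp in auto)
    then show ?thesis using False by simp
  qed
  then show "(case M of (E, \<I>) \<Rightarrow> (E - {e},
        if {e} \<in> \<I> then {I. I \<subseteq> E - {e} \<and> I \<union> {e} \<in> \<I>} else {I \<in> \<I>. I \<subseteq> E - {e}}))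
          \<in> {(E, \<I>). is_matroid E \<I>}"
    by (simp add: M)
qed

lemma ground_contract_elem: "ground (contract_elem e M) = ground M - {e}"
  and indep_contract_elem: "indep (contract_elem e M) =
    (if {e} \<in> indep M then {I. I \<subseteq> ground M - {e} \<and> I \<union> {e} \<in> indep M}
     else {I \<in> indep M. I \<subseteq> ground M - {e}})"
  by (transfer; auto)+

lemma contract_elem_commute:
  "contract_elem e (contract_elem f M) = contract_elem f (contract_elem e M)"
proof (cases "e = f")
  case ne: False
  have fin: "finite (ground M)"
    and down: "\<And>I J. I \<in> indep M \<Longrightarrow> J \<subseteq> I \<Longrightarrow> J \<in> indep M"
    and sub: "\<And>I. I \<in> indep M \<Longrightarrow> I \<subseteq> ground M"
    and aug: "\<And>I J. I \<in> indep M \<Longrightarrow> J \<in> indep M \<Longrightarrow> card I < card J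
                \<Longrightarrow> \<exists>x\<in>J - I. insert x I \<in> indep M"
    using matroid_axioms[of M] unfolding is_matroid_def by blast+
  have exchange: "I \<union> {b} \<in> indep M"
    if "I \<union> {a} \<in> indep M" "{b} \<in> indep M" "{a, b} \<notin> indep M" "a \<notin> I" "b \<notin> I" for I a b
  proof -
    have finI: "finite I" using that(1) sub fin by (meson Un_subset_iff finite_subset)
    have "\<exists>K \<in> indep M. b \<in> K \<and> K \<subseteq> I \<union> {a, b} \<and> card K = Suc k" if "k \<le> card I" for k
      using that
    proof (induction k)
      case 0
      then show ?case using \<open>{b} \<in> indep M\<close> by (intro bexI[of _ "{b}"]) auto
    next
      case (Suc k)
      then obtain K where K: "K \<in> indep M" "b \<in> K" "K \<subseteq> I \<union> {a, b}" "card K = Suc k" by auto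
      have "card K < card (I \<union> {a})"
        using K Suc.prems finI \<open>a \<notin> I\<close> by simp
      from aug[OF K(1) \<open>I \<union> {a} \<in> indep M\<close> this] obtain x
        where x: "x \<in> (I \<union> {a}) - K" "insert x K \<in> indep M" by blast
      have "finite K" using K(4) by (simp add: card_ge_0_finite)
      then show ?case using K x by (intro bexI[of _ "insert x K"]) auto
    qed
    then obtain K where K: "K \<in> indep M" "b \<in> K" "K \<subseteq> I \<union> {a, b}" "card K = Suc (card I)"
      by blast
    have "a \<notin> K" using K(1,2) down[of K "{a, b}"] \<open>{a, b} \<notin> indep M\<close> by blast
    then have "K \<subseteq> I \<union> {b}" using K(3) by blast
    moreover have "card (I \<union> {b}) = card K" using K(4) finI \<open>b \<notin> I\<close> by simp
    ultimately have "K = I \<union> {b}" using finI by (intro card_subset_eq) auto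
    then show ?thesis using K(1) by simp
  qed
  consider (indep) "{e, f} \<in> indep M" | (par) "{e} \<in> indep M" "{f} \<in> indep M" "{e, f} \<notin> indep M"
    | (e) "{e} \<notin> indep M" | (f) "{f} \<notin> indep M" by blast
  then have "indep (contract_elem e (contract_elem f M)) = indep (contract_elem f (contract_elem e M))"
  proof cases
    case indep
    then have "{e} \<in> indep M" "{f} \<in> indep M" using down by blast+
    then show ?thesis using indep ne sub
      by (auto simp: indep_contract_elem ground_contract_elem insert_commute)
  next
    case par
    have "I \<union> {e} \<in> indep M \<longleftrightarrow> I \<union> {f} \<in> indep M" if "e \<notin> I" "f \<notin> I" for I
      using that par exchange[of I e f] exchange[of I f e] by (metis insert_commute)
    then show ?thesis using par ne
      by (auto simp: indep_contract_elem ground_contract_elem insert_commute)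
  next
    case e
    then have "insert e I \<notin> indep M" "insert f (insert e I) \<notin> indep M" for I
      using down by blast+
    moreover have "{f} \<in> indep M \<Longrightarrow> f \<in> ground M" using sub by blast
    ultimately show ?thesis using e ne
      by (auto simp: indep_contract_elem ground_contract_elem insert_commute)
  next
    case f
    then have "insert f I \<notin> indep M" "insert e (insert f I) \<notin> indep M" for I
      using down by blast+
    moreover have "{e} \<in> indep M \<Longrightarrow> e \<in> ground M" using sub by blast
    ultimately show ?thesis using f ne
      by (auto simp: indep_contract_elem ground_contract_elem insert_commute)
  qed
  then show ?thesis by (intro matroid_eqI) (auto simp: ground_contract_elem)
qed simp

text \<open>Contraction of a finite set, one element at a time; by the preceding lemma the result does
  not depend on the order, so that \<open>Finite_Set.fold\<close> is well defined.\<close>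

definition contraction :: "'a matroid \<Rightarrow> 'a set \<Rightarrow> 'a matroid" where
  "contraction M A = Finite_Set.fold contract_elem M A"

lemma comp_fun_commute_contract_elem: "comp_fun_commute contract_elem"
  by standard (simp add: fun_eq_iff contract_elem_commute)

text \<open>The direct sum is meant for disjoint ground sets; otherwise it is the empty matroid.\<close>

lift_definition direct_sum :: "'a matroid \<Rightarrow> 'a matroid \<Rightarrow> 'a matroid" (infixr "\<oplus>" 65)
  is "\<lambda>(E, \<I>) (F, \<J>). if E \<inter> F = {} then (E \<union> F, {I \<union> J |I J. I \<in> \<I> \<and> J \<in> \<J>}) else ({}, {{}})"
proof -
  fix M N :: "'a set \<times> 'a set set"
  obtain E \<I> F \<J> where MN: "M = (E, \<I>)" "N = (F, \<J>)" by force
  assume "M \<in> {(E, \<I>). is_matroid E \<I>}" "N \<in> {(E, \<I>). is_matroid E \<I>}"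
  then have E: "is_matroid E \<I>" and F: "is_matroid F \<J>" using MN by simp_all
  let ?K = "{I \<union> J |I J. I \<in> \<I> \<and> J \<in> \<J>}"
  have "is_matroid (E \<union> F) ?K" if dis: "E \<inter> F = {}"
  proof -
    have sub: "I \<subseteq> E" "J \<subseteq> F" "finite I" "finite J" if "I \<in> \<I>" "J \<in> \<J>" for I J
      using that E F unfolding is_matroid_def by (meson finite_subset)+
    have down: "X \<in> ?K" if "I \<in> \<I>" "J \<in> \<J>" "X \<subseteq> I \<union> J" for I J X
    proof -
      have "X \<inter> I \<in> \<I>" using that(1) E unfolding is_matroid_def by (meson inf_le2)
      moreover have "X \<inter> J \<in> \<J>" using that(2) F unfolding is_matroid_def by (meson inf_le2)
      moreover have "X = (X \<inter> I) \<union> (X \<inter> J)" using that(3) by blast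
      ultimately show ?thesis by blast
    qed
    have aug: "\<exists>x\<in>(I' \<union> J') - (I \<union> J). insert x (I \<union> J) \<in> ?K"
      if I: "I \<in> \<I>" "I' \<in> \<I>" and J: "J \<in> \<J>" "J' \<in> \<J>" and c: "card (I \<union> J) < card (I' \<union> J')"
      for I J I' J'
    proof -
      have disj: "I \<inter> J = {}" "I' \<inter> J' = {}" "I' \<inter> J = {}" "I \<inter> J' = {}"
        using sub(1)[OF I(1) J(1)] sub(2)[OF I(1) J(1)] sub(1)[OF I(2) J(2)] sub(2)[OF I(2) J(2)] dis
        by blast+
      have "card (I \<union> J) = card I + card J"
        using card_Un_disjoint[OF sub(3,4)[OF I(1) J(1)] disj(1)] .
      moreover have "card (I' \<union> J') = card I' + card J'"
        using card_Un_disjoint[OF sub(3,4)[OF I(2) J(2)] disj(2)] .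
      ultimately consider "card I < card I'" | "card J < card J'" using c by linarith
      then show ?thesis
      proof cases
        case 1
        then obtain x where x: "x \<in> I' - I" "insert x I \<in> \<I>"
          using E I unfolding is_matroid_def by blast
        have "x \<notin> J" using x disj(3) by blast
        moreover have "insert x I \<union> J \<in> ?K" using x(2) J(1) by blast
        ultimately show ?thesis using x(1) by (intro bexI[of _ x]) simp_all
      next
        case 2
        then obtain x where x: "x \<in> J' - J" "insert x J \<in> \<J>"
          using F J unfolding is_matroid_def by blast
        have "x \<notin> I" using x disj(4) by blast
        moreover have "I \<union> insert x J \<in> ?K" using x(2) I(1) by blast
        ultimately show ?thesis using x(1) by (intro bexI[of _ x]) simp_all
      qed
    qed
    show ?thesis
    proof (rule is_matroidI)
      show "finite (E \<union> F)" using E F unfolding is_matroid_def by simp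
      have "{} \<in> \<I>" "{} \<in> \<J>" using E F unfolding is_matroid_def by simp_all
      then show "{} \<in> ?K" by blast
    next
      fix X assume "X \<in> ?K"
      then obtain I J where X: "X = I \<union> J" and IJ: "I \<in> \<I>" "J \<in> \<J>" by blast
      show "X \<subseteq> E \<union> F" using sub(1,2)[OF IJ] X by blast
    next
      fix X Y assume "X \<in> ?K" "Y \<subseteq> X"
      then obtain I J where X: "X = I \<union> J" and IJ: "I \<in> \<I>" "J \<in> \<J>" by blast
      show "Y \<in> ?K" using down[OF IJ] \<open>Y \<subseteq> X\<close> unfolding X .
    next
      fix X Y assume "X \<in> ?K" "Y \<in> ?K" and c: "card X < card Y"
      then obtain I J I' J' where X: "X = I \<union> J" and Y: "Y = I' \<union> J'"
        and IJ: "I \<in> \<I>" "I' \<in> \<I>" "J \<in> \<J>" "J' \<in> \<J>" by blast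
      show "\<exists>x\<in>Y - X. insert x X \<in> ?K" using aug[OF IJ] c unfolding X Y .
    qed
  qed
  then show "(case M of (E, \<I>) \<Rightarrow> \<lambda>(F, \<J>). if E \<inter> F = {} then
      (E \<union> F, {I \<union> J |I J. I \<in> \<I> \<and> J \<in> \<J>}) else ({}, {{}})) N \<in> {(E, \<I>). is_matroid E \<I>}"
    by (simp add: MN is_matroid_empty)
qed

lemma ground_direct_sum: "ground M \<inter> ground N = {} \<Longrightarrow> ground (M \<oplus> N) = ground M \<union> ground N"
  and indep_direct_sum: "ground M \<inter> ground N = {} \<Longrightarrow>
    indep (M \<oplus> N) = {I \<union> J |I J. I \<in> indep M \<and> J \<in> indep N}"
  by (transfer; auto)+

text \<open>\<open>partition_term\<close> below has ground set \<open>E\<close>, whereas \<open>B\<^sub>1 \<union> \<dots> \<union> B\<^sub>\<ell>\<close> may be smaller: the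
  elements of later blocks are loops, which are left out when the term is written as a sum of
  uniform matroids of positive rank.\<close>

definition delete_loops :: "'a matroid \<Rightarrow> 'a matroid" where
  "delete_loops M = restriction M {e. {e} \<in> indep M}"

text \<open>An ordered set partition \<open>(B\<^sub>1, \<dots>, B\<^sub>j)\<close> is the list \<open>\<pi>\<close> of its blocks, so that
  \<open>B\<^sub>i = \<pi> ! (i - 1)\<close>.\<close>

definition ordered_set_partition :: "'a set \<Rightarrow> 'a set list \<Rightarrow> bool" where
  "ordered_set_partition E \<pi> \<longleftrightarrow> distinct \<pi> \<and> partition_on E (set \<pi>)"

text \<open>\<open>B\<^sub>1 \<union> \<dots> \<union> B\<^sub>i\<close> and \<open>|B\<^sub>1| + \<dots> + |B\<^sub>i|\<close>\<close>

definition block_union :: "'a set list \<Rightarrow> nat \<Rightarrow> 'a set" where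
  "block_union \<pi> i = \<Union> (set (take i \<pi>))"

definition block_sum :: "'a set list \<Rightarrow> nat \<Rightarrow> nat" where
  "block_sum \<pi> i = sum_list (map card (take i \<pi>))"

text \<open>The last summand is the unrestricted contraction by all blocks but the last. For the empty
  list of blocks (the only ordered set partition of the empty set) the term is \<open>M\<close> itself.\<close>

definition partition_term :: "'a matroid \<Rightarrow> 'a set list \<Rightarrow> 'a matroid" where
  "partition_term M \<pi> =
     foldr (\<oplus>)
       (map (\<lambda>i. restriction (contraction M (block_union \<pi> i)) (\<pi> ! i)) [0..<length \<pi> - 1])
       (contraction M (block_union \<pi> (length \<pi> - 1)))"

end

theory Submission
  imports Defs
begin

text \<open>Contracting a set \<open>A\<close> of a uniform matroid of rank \<open>m\<close> leaves the uniform matroid of rank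
  \<open>m - |A|\<close> on the remaining elements, where the subtraction is truncated at \<open>0\<close>. Hence the term of
  \<open>\<pi>\<close> is the direct sum of the uniform matroids of rank \<open>m - (k\<^sub>1 + \<dots> + k\<^sub>i)\<close> on \<open>B\<^bsub>i+1\<^esub>\<close>, and this rank
  is at least \<open>k\<^bsub>i+1\<^esub>\<close> (so the summand is free) for the blocks before \<open>B\<^sub>\<ell>\<close>, and \<open>0\<close> for the blocks
  after it.\<close>

section \<open>Direct sums and deletion of loops\<close>

lemma indep_subset_ground: "I \<in> indep M \<Longrightarrow> I \<subseteq> ground M"
  using matroid_axioms[of M] unfolding is_matroid_def by blast

text \<open>Disjointness of the ground sets makes the decomposition of \<open>I\<close> unique: its
  pieces are the traces on the two ground sets. This trades an existential for conditions that can
  be checked separately.\<close>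

lemma indep_direct_sum_iff:
  assumes "ground M \<inter> ground N = {}"
  shows "I \<in> indep (M \<oplus> N) \<longleftrightarrow>
    I \<subseteq> ground M \<union> ground N \<and> I \<inter> ground M \<in> indep M \<and> I \<inter> ground N \<in> indep N"
    (is "?L \<longleftrightarrow> ?R")
proof
  assume ?L
  then obtain J K where I: "I = J \<union> K" and JK: "J \<in> indep M" "K \<in> indep N"
    unfolding indep_direct_sum[OF assms] mem_Collect_eq by (elim exE conjE)
  have sub: "J \<subseteq> ground M" "K \<subseteq> ground N" using JK indep_subset_ground by blast+
  then have "I \<inter> ground M = J" "I \<inter> ground N = K" using assms I by blast+
  then show ?R using I JK sub by blast
next
  assume ?R
  then have "I = (I \<inter> ground M) \<union> (I \<inter> ground N)"
    and "I \<inter> ground M \<in> indep M" "I \<inter> ground N \<in> indep N" by auto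
  then show ?L unfolding indep_direct_sum[OF assms] by (intro CollectI exI conjI)
qed

lemma direct_sum_uniform_empty: "M \<oplus> uniform 0 {} = M"
proof (rule matroid_eqI)
  show "indep (M \<oplus> uniform 0 {}) = indep M"
    by (auto simp: indep_direct_sum ground_uniform indep_uniform)
qed (simp add: ground_direct_sum ground_uniform)

lemma ground_delete_loops: "ground (delete_loops M) = {e. {e} \<in> indep M}"
  using indep_subset_ground by (fastforce simp: delete_loops_def ground_restriction)

text \<open>Subsets of independent sets are independent, so an independent set contains no loop;
  deleting loops only shrinks the ground set.\<close>

lemma indep_delete_loops: "indep (delete_loops M) = indep M"
proof -
  have "{e} \<in> indep M" if "I \<in> indep M" "e \<in> I" for I e
    using that matroid_axioms[of M] unfolding is_matroid_def by (meson empty_subsetI insert_subset)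
  then show ?thesis by (auto simp: delete_loops_def indep_restriction)
qed

lemma delete_loops_direct_sum:
  assumes "ground M \<inter> ground N = {}"
  shows "delete_loops (M \<oplus> N) = delete_loops M \<oplus> delete_loops N"
proof -
  have emp: "{} \<in> indep M" "{} \<in> indep N"
    using matroid_axioms unfolding is_matroid_def by blast+
  have sub: "ground (delete_loops M) \<subseteq> ground M" "ground (delete_loops N) \<subseteq> ground N"
    by (auto simp: delete_loops_def ground_restriction)
  then have disj: "ground (delete_loops M) \<inter> ground (delete_loops N) = {}"
    using assms by blast
  have indep: "indep (delete_loops (M \<oplus> N)) = indep (delete_loops M \<oplus> delete_loops N)"
    by (simp add: indep_delete_loops indep_direct_sum[OF assms] indep_direct_sum[OF disj])
  \<comment> \<open>A singleton splits into two sets only with each of them empty or the singleton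
    itself, so the non-loops of the sum are those of the summands.\<close>
  have "{e} \<in> indep (M \<oplus> N) \<longleftrightarrow> {e} \<in> indep M \<or> {e} \<in> indep N" for e
  proof -
    have "{e} \<in> indep (M \<oplus> N) \<longleftrightarrow> (\<exists>I\<in>indep M. \<exists>J\<in>indep N. {e} = I \<union> J)"
      by (auto simp: indep_direct_sum[OF assms])
    also have "\<dots> \<longleftrightarrow> {e} \<in> indep M \<or> {e} \<in> indep N"
      using emp by (metis Un_empty_left Un_empty_right subset_singletonD sup_ge1 sup_ge2 insert_not_empty)
    finally show ?thesis .
  qed
  then show ?thesis
    using indep by (intro matroid_eqI) (auto simp: ground_delete_loops ground_direct_sum[OF disj])
qed

text \<open>In rank 0 every element is a loop, in positive rank none is.\<close>

lemma delete_loops_uniform: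
  assumes "finite E"
  shows "delete_loops (uniform m E) = (if m = 0 then uniform 0 {} else uniform m E)"
  using assms
  by (intro matroid_eqI)
    (auto simp: ground_delete_loops indep_delete_loops ground_uniform indep_uniform finite_subset)

section \<open>Minors of uniform matroids\<close>

lemma contract_elem_uniform:
  assumes "finite E" "e \<in> E"
  shows "contract_elem e (uniform m E) = uniform (m - 1) (E - {e})"
proof (rule matroid_eqI)
  have "card (insert e I) = Suc (card I)" if "I \<subseteq> E - {e}" for I
    using that assms(1) by (meson Diff_iff card_insert_disjoint finite_Diff finite_subset singletonI subsetD)
  \<comment> \<open>For \<open>m = 0\<close> the element \<open>e\<close> is a loop and is deleted;
    the truncated \<open>m - 1 = 0\<close> is then the correct rank.\<close>
  then show "indep (contract_elem e (uniform m E)) = indep (uniform (m - 1) (E - {e}))"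
    using assms by (auto simp: indep_contract_elem ground_uniform indep_uniform)
qed (use assms in \<open>simp add: ground_contract_elem ground_uniform\<close>)

lemma contraction_uniform:
  assumes "finite E" "A \<subseteq> E"
  shows "contraction (uniform m E) A = uniform (m - card A) (E - A)"
proof -
  interpret comp_fun_commute contract_elem by (rule comp_fun_commute_contract_elem)
  have "finite A" using assms finite_subset by blast
  then show ?thesis using assms(2)
  proof (induction A)
    case (insert e A)
    then have "contraction (uniform m E) (insert e A) =
        contract_elem e (uniform (m - card A) (E - A))"
      by (simp add: contraction_def)
    also have "\<dots> = uniform (m - card A - 1) (E - A - {e})"
      using insert assms(1) by (intro contract_elem_uniform) auto
    finally show ?case using insert by (simp flip: Diff_insert)
  qed (simp add: contraction_def)
qed

text \<open>The parameter \<open>m\<close> is kept even if it exceeds \<open>card A\<close>; the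
  result is then the free matroid on \<open>A\<close>.\<close>

lemma restriction_uniform:
  assumes "finite E" "A \<subseteq> E"
  shows "restriction (uniform m E) A = uniform m A"
  using assms finite_subset[OF assms(2,1)]
  by (intro matroid_eqI) (auto simp: ground_restriction indep_restriction ground_uniform indep_uniform)

section \<open>Unions and sizes of initial blocks\<close>

lemma block_union_0 [simp]: "block_union \<pi> 0 = {}"
  and block_union_Cons_Suc [simp]: "block_union (B # \<pi>) (Suc i) = B \<union> block_union \<pi> i"
  by (simp_all add: block_union_def)

lemma block_sum_0 [simp]: "block_sum \<pi> 0 = 0"
  and block_sum_Cons_Suc [simp]: "block_sum (B # \<pi>) (Suc i) = card B + block_sum \<pi> i"
  by (simp_all add: block_sum_def)

lemma block_union_Suc: "i < length \<pi> \<Longrightarrow> block_union \<pi> (Suc i) = block_union \<pi> i \<union> \<pi> ! i"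
  by (auto simp: block_union_def take_Suc_conv_app_nth)

lemma block_sum_Suc: "i < length \<pi> \<Longrightarrow> block_sum \<pi> (Suc i) = block_sum \<pi> i + card (\<pi> ! i)"
  by (auto simp: block_sum_def take_Suc_conv_app_nth)

lemma block_sum_mono:
  assumes "i \<le> j"
  shows "block_sum \<pi> i \<le> block_sum \<pi> j"
proof -
  have "take j \<pi> = take i \<pi> @ take (j - i) (drop i \<pi>)"
    using assms by (metis le_add_diff_inverse take_add)
  then show ?thesis by (simp add: block_sum_def)
qed

lemma ordered_set_partition_Nil [simp]: "ordered_set_partition E [] \<longleftrightarrow> E = {}"
  by (auto simp: ordered_set_partition_def partition_on_def)

text \<open>Inductions over the list of blocks use this to pass from \<open>E\<close> to
  \<open>E - B\<close>, which is why they generalise over the ground set.\<close>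

lemma ordered_set_partition_ConsD:
  assumes "ordered_set_partition E (B # \<pi>)"
  shows "B \<subseteq> E" "ordered_set_partition (E - B) \<pi>"
proof -
  from assms have dist: "B \<notin> set \<pi>" "distinct \<pi>" and U: "E = B \<union> \<Union>(set \<pi>)"
    and disj: "disjoint (insert B (set \<pi>))" and ne: "{} \<notin> set \<pi>"
    by (auto simp: ordered_set_partition_def partition_on_def)
  then show "B \<subseteq> E" by blast
  have "B \<inter> C = {}" if "C \<in> set \<pi>" for C
    using disj dist that by (auto simp: disjoint_def)
  then have "E - B = \<Union>(set \<pi>)" using U by blast
  then show "ordered_set_partition (E - B) \<pi>"
    using dist disj ne by (auto simp: ordered_set_partition_def partition_on_def disjoint_def)
qed

lemma ordered_set_partition_nth_disjoint:
  assumes "ordered_set_partition E \<pi>" "i < length \<pi>" "j < length \<pi>" "i \<noteq> j"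
  shows "\<pi> ! i \<inter> \<pi> ! j = {}"
  using assms
  by (auto simp: ordered_set_partition_def partition_on_def disjoint_def nth_eq_iff_index_eq)

lemma block_union_length: "ordered_set_partition E \<pi> \<Longrightarrow> block_union \<pi> (length \<pi>) = E"
  by (auto simp: block_union_def ordered_set_partition_def partition_on_def)

lemma block_union_subset: "ordered_set_partition E \<pi> \<Longrightarrow> block_union \<pi> i \<subseteq> E"
  by (auto simp: block_union_def ordered_set_partition_def partition_on_def dest: in_set_takeD)

lemma mem_block_union_iff:
  "i \<le> length \<pi> \<Longrightarrow> e \<in> block_union \<pi> i \<longleftrightarrow> (\<exists>k<i. e \<in> \<pi> ! k)"
  by (fastforce simp: block_union_def in_set_conv_nth)

lemma card_block_union:
  assumes "finite E" "ordered_set_partition E \<pi>"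
  shows "card (block_union \<pi> i) = block_sum \<pi> i"
  using assms
proof (induction \<pi> arbitrary: E i)
  case Nil
  then show ?case by (simp add: block_union_def block_sum_def)
next
  case (Cons B \<pi>)
  note D = ordered_set_partition_ConsD[OF Cons.prems(2)]
  show ?case
  proof (cases i)
    case (Suc k)
    have sub: "block_union \<pi> k \<subseteq> E - B" using D(2) by (rule block_union_subset)
    then have "card (B \<union> block_union \<pi> k) = card B + card (block_union \<pi> k)"
      using D(1) Cons.prems(1) by (intro card_Un_disjoint) (auto intro: finite_subset)
    then show ?thesis using Suc Cons.IH[of "E - B" k] Cons.prems(1) D(2) by simp
  qed simp
qed

section \<open>The term of a uniform matroid\<close>

text \<open>Contracting \<open>B\<close> first leaves a uniform matroid, so the later summands form
  the term of a uniform matroid again. A block must follow \<open>B\<close> for the list of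
  restricted summands to have a first entry.\<close>

lemma partition_term_uniform_Cons:
  assumes "finite E" "ordered_set_partition E (B # \<pi>)" "\<pi> \<noteq> []"
  shows "partition_term (uniform m E) (B # \<pi>) =
    uniform m B \<oplus> partition_term (uniform (m - card B) (E - B)) \<pi>"
proof -
  note D = ordered_set_partition_ConsD[OF assms(2)]
  \<comment> \<open>Both sides evaluate to the same uniform matroid, since the sizes of
    \<open>B\<close> and of the later blocks add up.\<close>
  have contr: "contraction (uniform m E) (block_union (B # \<pi>) (Suc i)) =
      contraction (uniform (m - card B) (E - B)) (block_union \<pi> i)" for i
  proof -
    have sub: "block_union \<pi> i \<subseteq> E - B" using D(2) by (rule block_union_subset)
    then have "card (B \<union> block_union \<pi> i) = card B + card (block_union \<pi> i)"
      using D(1) assms(1) by (intro card_Un_disjoint) (auto intro: finite_subset)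
    moreover have "B \<union> block_union \<pi> i \<subseteq> E" using sub D(1) by blast
    ultimately show ?thesis
      using sub assms(1) by (simp add: contraction_uniform Diff_Diff_Int set_diff_eq conj_ac)
  qed
  \<comment> \<open>The successor form of the length exposes index 0 of the range; the remaining
    indices are shifted down by one to run over \<open>\<pi>\<close>.\<close>
  obtain j where j: "length \<pi> = Suc j" using assms(3) by (cases \<pi>) auto
  have "restriction (contraction (uniform m E) {}) B = uniform m B"
    using D(1) assms(1) by (simp add: contraction_uniform restriction_uniform)
  then show ?thesis
    unfolding partition_term_def
    by (simp add: j upt_conv_Cons map_Suc_upt[symmetric] contr comp_def
        del: upt_Suc block_union_Cons_Suc)
qed

text \<open>Independence is tested block by block against the rank left over by the preceding
  blocks. Truncated subtraction turns the bound into 0 once that rank is used up.\<close>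

lemma partition_term_uniform:
  assumes "finite E" "ordered_set_partition E \<pi>" "m \<le> card E"
  shows "ground (partition_term (uniform m E) \<pi>) = E \<and>
    indep (partition_term (uniform m E) \<pi>) =
      {I. I \<subseteq> E \<and> (\<forall>i<length \<pi>. card (I \<inter> \<pi> ! i) \<le> m - block_sum \<pi> i)}"
  using assms
proof (induction \<pi> arbitrary: E m)
  case Nil
  then show ?case
    by (auto simp: partition_term_def contraction_uniform ground_uniform indep_uniform)
next
  case (Cons B \<pi>)
  note D = ordered_set_partition_ConsD[OF Cons.prems(2)]
  note fin = \<open>finite E\<close>
  have finB: "finite B" using fin D(1) finite_subset by blast
  show ?case
  proof (cases "\<pi> = []")
    case True
    then have "B = E" using D by auto
    then show ?thesis using True fin
      by (auto simp: partition_term_def contraction_uniform ground_uniform indep_uniform Int_absorb2)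
  next
    case False
    let ?N = "partition_term (uniform (m - card B) (E - B)) \<pi>"
    have "m - card B \<le> card (E - B)" using Cons.prems(3) D(1) finB by (simp add: card_Diff_subset)
    then have N: "ground ?N = E - B"
      "indep ?N = {I. I \<subseteq> E - B \<and> (\<forall>i<length \<pi>. card (I \<inter> \<pi> ! i) \<le> m - card B - block_sum \<pi> i)}"
      using Cons.IH[of "E - B" "m - card B"] fin D(2) by simp_all
    have eq: "partition_term (uniform m E) (B # \<pi>) = uniform m B \<oplus> ?N"
      using partition_term_uniform_Cons[OF fin Cons.prems(2) False] .
    have disj: "ground (uniform m B) \<inter> ground ?N = {}" using finB N by (simp add: ground_uniform)
    have sub: "\<pi> ! i \<subseteq> E - B" if "i < length \<pi>" for i
      using that D(2) by (auto simp: ordered_set_partition_def partition_on_def)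
    have "I \<in> indep (uniform m B \<oplus> ?N) \<longleftrightarrow>
        I \<subseteq> E \<and> (\<forall>i<length (B # \<pi>). card (I \<inter> (B # \<pi>) ! i) \<le> m - block_sum (B # \<pi>) i)" for I
    proof -
      have int: "I \<inter> (E - B) \<inter> \<pi> ! i = I \<inter> \<pi> ! i" if "i < length \<pi>" for i
        using sub[OF that] by blast
      have "I \<in> indep (uniform m B \<oplus> ?N) \<longleftrightarrow> I \<subseteq> E \<and> card (I \<inter> B) \<le> m \<and>
          (\<forall>i<length \<pi>. card (I \<inter> (E - B) \<inter> \<pi> ! i) \<le> m - card B - block_sum \<pi> i)"
        using D(1) finB by (auto simp: indep_direct_sum_iff[OF disj] N ground_uniform indep_uniform)
      \<comment> \<open>The quantifier splits into index 0, the block \<open>B\<close> with bound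
        \<open>m\<close>, and the shifted indices of \<open>\<pi>\<close>.\<close>
      then show ?thesis using int by (simp add: All_less_Suc2)
    qed
    then show ?thesis using eq D(1) finB by (auto simp: ground_direct_sum[OF disj] N ground_uniform)
  qed
qed

text \<open>Blocks before the critical one are smaller than their bound, and blocks after it have
  bound 0, so only the critical block \<open>\<pi> ! (l - 1)\<close> keeps a cardinality condition.
  For \<open>l = 0\<close> there is no such block; then \<open>m = 0\<close> and only the empty set
  is independent.\<close>

lemma partition_term_uniform_critical:
  assumes "finite E" "ordered_set_partition E \<pi>" "m \<le> card E" "l \<le> length \<pi>"
    and below: "\<And>i. i < l \<Longrightarrow> block_sum \<pi> i < m" and above: "m \<le> block_sum \<pi> l"
  shows "I \<in> indep (partition_term (uniform m E) \<pi>) \<longleftrightarrow> I \<subseteq> block_union \<pi> l \<and>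
    (0 < l \<longrightarrow> card (I \<inter> \<pi> ! (l - 1)) \<le> m - block_sum \<pi> (l - 1))" (is "?L \<longleftrightarrow> ?R")
proof -
  have char: "?L \<longleftrightarrow> I \<subseteq> E \<and> (\<forall>i<length \<pi>. card (I \<inter> \<pi> ! i) \<le> m - block_sum \<pi> i)"
    using partition_term_uniform[OF assms(1-3)] by simp
  have finB: "finite (\<pi> ! i)" if "i < length \<pi>" for i
  proof -
    have "\<pi> ! i \<subseteq> E"
      using that assms(2) by (auto simp: ordered_set_partition_def partition_on_def)
    then show ?thesis using assms(1) finite_subset by blast
  qed
  show ?thesis
  proof
    assume ?L
    then have I: "I \<subseteq> E" "\<And>i. i < length \<pi> \<Longrightarrow> card (I \<inter> \<pi> ! i) \<le> m - block_sum \<pi> i"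
      using char by blast+
    have "I \<subseteq> block_union \<pi> l"
    proof
      fix e assume "e \<in> I"
      then have "e \<in> block_union \<pi> (length \<pi>)" using I(1) block_union_length assms(2) by blast
      then obtain i where i: "i < length \<pi>" "e \<in> \<pi> ! i" by (auto simp: mem_block_union_iff)
      \<comment> \<open>A block that meets \<open>I\<close> has a positive bound, so the rank is not
        exhausted before it and its index lies below \<open>l\<close>.\<close>
      have "I \<inter> \<pi> ! i \<noteq> {}" using i \<open>e \<in> I\<close> by blast
      then have "0 < card (I \<inter> \<pi> ! i)" using finB[OF i(1)] by (simp add: card_gt_0_iff)
      then have "\<not> m \<le> block_sum \<pi> i" using I(2)[OF i(1)] by simp
      then have "i < l" using above block_sum_mono[of l i \<pi>] by (meson le_trans not_le)
      then show "e \<in> block_union \<pi> l" using i assms(4) by (auto simp: mem_block_union_iff)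
    qed
    then show ?R using I(2) assms(4) by auto
  next
    assume R: ?R
    have "card (I \<inter> \<pi> ! i) \<le> m - block_sum \<pi> i" if i: "i < length \<pi>" for i
    proof -
      consider "i + 1 = l" | "i + 1 < l" | "l \<le> i" by linarith
      then show ?thesis
      proof cases
        case 1
        then show ?thesis using R by auto
      next
        case 2
        \<comment> \<open>The partial sum including block \<open>i\<close> is still below
          \<open>m\<close>, so the bound exceeds the size of the block.\<close>
        then have "block_sum \<pi> i + card (\<pi> ! i) < m" using below[of "i + 1"] i block_sum_Suc[OF i] by simp
        moreover have "card (I \<inter> \<pi> ! i) \<le> card (\<pi> ! i)" using finB[OF i] by (simp add: card_mono)
        ultimately show ?thesis by linarith
      next
        case 3
        \<comment> \<open>\<open>I\<close> lies in the first \<open>l\<close> blocks, which are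
          disjoint from this one.\<close>
        have "e \<notin> I \<inter> \<pi> ! i" for e
        proof
          assume e: "e \<in> I \<inter> \<pi> ! i"
          then obtain k where k: "k < l" "e \<in> \<pi> ! k"
            using R mem_block_union_iff[OF assms(4), of e] by auto
          then have "\<pi> ! k \<inter> \<pi> ! i = {}"
            using 3 i by (intro ordered_set_partition_nth_disjoint[OF assms(2)]) auto
          then show False using k e by blast
        qed
        then show ?thesis by (metis all_not_in_conv card.empty le0)
      qed
    qed
    then show ?L using char R block_union_subset[OF assms(2)] by blast
  qed
qed

section \<open>Exact fit and overshoot at the critical block\<close>

theorem theorem3p3:
  fixes E :: "'a set" and m n l :: nat and M :: "'a matroid" and \<pi> :: "'a set list"
  assumes "finite E" and "card E = n" and "m \<le> n"
    and "M = uniform m E"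
    and "ordered_set_partition E \<pi>"
    and "l = (LEAST i. m \<le> block_sum \<pi> i)"
  shows
    "(block_sum \<pi> l = m \<longrightarrow>
        partition_term M \<pi> =
          uniform m (block_union \<pi> l) \<oplus> uniform 0 (E - block_union \<pi> l) \<and>
        delete_loops (partition_term M \<pi>) = uniform m (block_union \<pi> l)) \<and>
     (block_sum \<pi> l > m \<longrightarrow>
        partition_term M \<pi> =
          (uniform (block_sum \<pi> (l - 1)) (block_union \<pi> (l - 1)) \<oplus>
           uniform (m - block_sum \<pi> (l - 1)) (\<pi> ! (l - 1))) \<oplus>
          uniform 0 (E - block_union \<pi> l) \<and>
        delete_loops (partition_term M \<pi>) =
          uniform (block_sum \<pi> (l - 1)) (block_union \<pi> (l - 1)) \<oplus>
          uniform (m - block_sum \<pi> (l - 1)) (\<pi> ! (l - 1)))"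
proof -
  note fin = assms(1) and part = assms(5)
  let ?T = "partition_term M \<pi>" and ?U = "block_union \<pi> l" and ?p = "l - 1"
  have mE: "m \<le> card E" using assms by simp
  \<comment> \<open>All blocks together have size \<open>card E\<close>, so some index qualifies and
    the least one exists.\<close>
  have "m \<le> block_sum \<pi> (length \<pi>)"
    using mE card_block_union[OF fin part, of "length \<pi>"] block_union_length[OF part] by simp
  then have l: "l \<le> length \<pi>" and above: "m \<le> block_sum \<pi> l"
    unfolding assms(6) by (auto intro: Least_le LeastI)
  have below: "block_sum \<pi> i < m" if "i < l" for i
    using not_less_Least[of i "\<lambda>i. m \<le> block_sum \<pi> i"] that assms(6) by auto
  have groundT: "ground ?T = E"
    using partition_term_uniform[OF fin part mE] assms(4) by simp
  have indepT: "I \<in> indep ?T \<longleftrightarrow>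
      I \<subseteq> ?U \<and> (0 < l \<longrightarrow> card (I \<inter> \<pi> ! ?p) \<le> m - block_sum \<pi> ?p)" for I
    using partition_term_uniform_critical[OF fin part mE l below above] assms(4) by simp
  have UE: "block_union \<pi> i \<subseteq> E" for i using block_union_subset[OF part] .
  then have finU: "finite (block_union \<pi> i)" for i using fin finite_subset by blast
  have cardU: "card (block_union \<pi> i) = block_sum \<pi> i" for i using card_block_union[OF fin part] .
  \<comment> \<open>Common to both cases: a loopless \<open>N\<close> on the first \<open>l\<close>
    blocks with the independent sets of the term determines it, the rest of \<open>E\<close> being
    loops.\<close>
  have summand: "?T = N \<oplus> uniform 0 (E - ?U) \<and> delete_loops ?T = N"
    if N: "ground N = ?U" and iff: "\<And>I. I \<in> indep ?T \<longleftrightarrow> I \<in> indep N"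
      and loopless: "delete_loops N = N" for N
  proof -
    let ?Z = "uniform 0 (E - ?U)"
    have disj: "ground N \<inter> ground ?Z = {}" using N fin by (simp add: ground_uniform)
    have "J \<in> indep ?Z \<longleftrightarrow> J = {}" for J
      using finite_subset[of J "E - ?U"] fin by (auto simp: indep_uniform card_eq_0_iff)
    then have "indep ?T = indep (N \<oplus> ?Z)" using iff by (auto simp: indep_direct_sum[OF disj])
    moreover have "ground ?T = ground (N \<oplus> ?Z)"
      using N UE[of l] fin by (auto simp: groundT ground_direct_sum[OF disj] ground_uniform)
    ultimately have eq: "?T = N \<oplus> ?Z" by (intro matroid_eqI)
    then show ?thesis
      using delete_loops_direct_sum[OF disj] loopless fin
      by (simp add: delete_loops_uniform direct_sum_uniform_empty)
  qed
  have "?T = uniform m ?U \<oplus> uniform 0 (E - ?U) \<and> delete_loops ?T = uniform m ?U"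
    if eq: "block_sum \<pi> l = m"
  proof (rule summand)
    \<comment> \<open>Here \<open>card ?U = m\<close>, so rank 0 occurs only for empty
      \<open>?U\<close>.\<close>
    show "delete_loops (uniform m ?U) = uniform m ?U"
      using finU[of l] cardU[of l] eq by (auto simp: delete_loops_uniform)
    fix I
    \<comment> \<open>In an exact fit the critical bound equals the size of the critical block and
      holds for every \<open>I\<close>.\<close>
    have "card (I \<inter> \<pi> ! ?p) \<le> m - block_sum \<pi> ?p" if "0 < l"
    proof -
      have "block_sum \<pi> l = block_sum \<pi> ?p + card (\<pi> ! ?p)" and "\<pi> ! ?p \<subseteq> ?U"
        using that l block_sum_Suc[of ?p \<pi>] block_union_Suc[of ?p \<pi>] by auto
      then show ?thesis using finU[of l] eq
        by (metis add_diff_cancel_left' card_mono finite_subset inf_le2)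
    qed
    moreover have "card I \<le> m" if "I \<subseteq> ?U" using that finU cardU eq card_mono by metis
    ultimately show "I \<in> indep ?T \<longleftrightarrow> I \<in> indep (uniform m ?U)"
      using indepT finU by (auto simp: indep_uniform)
  qed (simp add: ground_uniform finU)
  moreover have "?T = (uniform (block_sum \<pi> ?p) (block_union \<pi> ?p) \<oplus>
        uniform (m - block_sum \<pi> ?p) (\<pi> ! ?p)) \<oplus> uniform 0 (E - ?U) \<and>
      delete_loops ?T = uniform (block_sum \<pi> ?p) (block_union \<pi> ?p) \<oplus>
        uniform (m - block_sum \<pi> ?p) (\<pi> ! ?p)"
    if gt: "m < block_sum \<pi> l"
  proof (rule summand)
    let ?P = "block_union \<pi> ?p" and ?B = "\<pi> ! ?p"
    let ?N1 = "uniform (block_sum \<pi> ?p) ?P" and ?N2 = "uniform (m - block_sum \<pi> ?p) ?B"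
    \<comment> \<open>The empty partial sum is 0 and cannot overshoot \<open>m\<close>, so
      \<open>l - 1\<close> is a genuine predecessor.\<close>
    have l0: "0 < l" using gt by (cases l) auto
    then have U: "?U = ?P \<union> ?B" using l block_union_Suc[of ?p \<pi>] by simp
    then have finB: "finite ?B" using finU[of l] by simp
    have PB: "?P \<inter> ?B = {}"
    proof -
      have "e \<notin> ?B" if e: "e \<in> ?P" for e
      proof -
        have "?p \<le> length \<pi>" using l by linarith
        then obtain k where k: "k < ?p" "e \<in> \<pi> ! k" using e by (auto simp: mem_block_union_iff)
        then have "\<pi> ! k \<inter> ?B = {}"
          using l l0 by (intro ordered_set_partition_nth_disjoint[OF part]) auto
        then show ?thesis using k by blast
      qed
      then show ?thesis by blast
    qed
    then have disj: "ground ?N1 \<inter> ground ?N2 = {}" using finU finB by (simp add: ground_uniform)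
    show "ground (?N1 \<oplus> ?N2) = ?U"
      using ground_direct_sum[OF disj] U finU finB by (simp add: ground_uniform)
    \<comment> \<open>Minimality of \<open>l\<close> leaves positive rank for the critical block, so
      it contains no loops.\<close>
    have "m - block_sum \<pi> ?p \<noteq> 0" using below[of ?p] l0 by simp
    then have "delete_loops ?N2 = ?N2" using finB by (simp add: delete_loops_uniform)
    moreover have "delete_loops ?N1 = ?N1"
      using finU[of ?p] cardU[of ?p] by (auto simp: delete_loops_uniform)
    ultimately show "delete_loops (?N1 \<oplus> ?N2) = ?N1 \<oplus> ?N2"
      unfolding delete_loops_direct_sum[OF disj] by simp
    fix I
    \<comment> \<open>The first summand is free, so only the bound on the critical block
      remains.\<close>
    have "card (I \<inter> ?P) \<le> block_sum \<pi> ?p" using finU cardU by (metis card_mono inf_le2)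
    then show "I \<in> indep ?T \<longleftrightarrow> I \<in> indep (?N1 \<oplus> ?N2)"
      unfolding indepT indep_direct_sum_iff[OF disj]
      using finU finB l0 U by (simp add: ground_uniform indep_uniform)
  qed
  ultimately show ?thesis by blast
qed

end
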